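(* Let $T$ be a tree of order $n\ge 8$ and let $e$ be a non-pendent edge of $T$ (an edge neither of whose endpoints has degree $1$). Let $T-e=T_1\cup T_2$, and let $\sigma$ be the number of Laplacian eigenvalues of $T-e$ (counted with multiplicity) which are greater than or equal to the average degree $\overline{d}(T-e)=2-\frac{4}{n}$. For $i=1,2$ let $k_i$ be the number of Laplacian eigenvalues of $T_i$ which are greater than or equal to $\overline{d}(T-e)$ (so $k_1+k_2=\sigma$). Then \[LE(T)\ge 2S_{k_{1}}(T_1)+2S_{k_{2}}(T_2)-4\sigma+\frac{4\sigma}{n}.\]
   Context: For a graph $G$ with $n$ vertices and $m$ edges, let $\mu_1\ge\dots\ge\mu_n$ be the eigenvalues of the Laplacian matrix $D(G)-A(G)$, $\overline{d}=2m/n$, and $LE(G)=\sum_{i=1}^n|\mu_i-\overline{d}|$ the Laplacian energy. $S_k(G)=\sum_{i=1}^k\mu_i$ is the sum of the $k$ largest Laplacian eigenvalues (with $S_0=0$). *)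

theory Defs
  imports "Jordan_Normal_Form.Char_Poly" "HOL-Library.Multiset"
begin

section \<open>Finite simple graphs\<close>

text \<open>
  The digraph library has no usable notion of an undirected tree: it models an undirected edge as
  a pair of opposite arcs, and these form a cycle there. Here edges are two-element vertex sets.
\<close>

record 'a ugraph =
  verts :: "'a set"
  edges :: "'a set set"

definition simple_graph :: "'a ugraph \<Rightarrow> bool" where
  "simple_graph G \<longleftrightarrow> finite (verts G) \<and> (\<forall>e \<in> edges G. e \<subseteq> verts G \<and> card e = 2)"

definition adj_rel :: "'a ugraph \<Rightarrow> ('a \<times> 'a) set" where
  "adj_rel G = {(u, v). {u, v} \<in> edges G}"

definition vdegree :: "'a ugraph \<Rightarrow> 'a \<Rightarrow> nat" where
  "vdegree G v = card {e \<in> edges G. v \<in> e}"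

definition connected_graph :: "'a ugraph \<Rightarrow> bool" where
  "connected_graph G \<longleftrightarrow> verts G \<noteq> {} \<and> (\<forall>u \<in> verts G. \<forall>v \<in> verts G. (u, v) \<in> (adj_rel G)\<^sup>*)"

text \<open>A cycle is given by its vertices in cyclic order, without repeating the first one.\<close>

definition is_cycle :: "'a ugraph \<Rightarrow> 'a list \<Rightarrow> bool" where
  "is_cycle G c \<longleftrightarrow> length c \<ge> 3 \<and> distinct c \<and>
     (\<forall>i < length c. {c ! i, c ! (Suc i mod length c)} \<in> edges G)"

definition tree :: "'a ugraph \<Rightarrow> bool" where
  "tree G \<longleftrightarrow> simple_graph G \<and> connected_graph G \<and> (\<nexists>c. is_cycle G c)"

definition delete_edge :: "'a ugraph \<Rightarrow> 'a set \<Rightarrow> 'a ugraph" where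
  "delete_edge G e = \<lparr>verts = verts G, edges = edges G - {e}\<rparr>"

definition induced_subgraph :: "'a ugraph \<Rightarrow> 'a set \<Rightarrow> 'a ugraph" where
  "induced_subgraph G U = \<lparr>verts = U, edges = {e \<in> edges G. e \<subseteq> U}\<rparr>"

definition component_of :: "'a ugraph \<Rightarrow> 'a \<Rightarrow> 'a ugraph" where
  "component_of G v = induced_subgraph G {w \<in> verts G. (v, w) \<in> (adj_rel G)\<^sup>*}"

definition components :: "'a ugraph \<Rightarrow> 'a ugraph set" where
  "components G = component_of G ` verts G"

definition non_pendent_edge :: "'a ugraph \<Rightarrow> 'a set \<Rightarrow> bool" where
  "non_pendent_edge G e \<longleftrightarrow> e \<in> edges G \<and> (\<forall>v \<in> e. vdegree G v \<noteq> 1)"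

definition avg_degree :: "'a ugraph \<Rightarrow> real" where
  "avg_degree G = 2 * real (card (edges G)) / real (card (verts G))"


section \<open>Laplacian spectrum and Laplacian energy\<close>

text \<open>
  Matrices are indexed by natural numbers, so the vertices are enumerated by an arbitrary but fixed
  list. Another enumeration conjugates the matrices by a permutation matrix, which leaves the
  characteristic polynomial unchanged.
\<close>

definition vertex_list :: "'a ugraph \<Rightarrow> 'a list" where
  "vertex_list G = (SOME xs. distinct xs \<and> set xs = verts G)"

definition adjacency_matrix :: "'a ugraph \<Rightarrow> real mat" where
  "adjacency_matrix G = mat (card (verts G)) (card (verts G))
     (\<lambda>(i, j). if {vertex_list G ! i, vertex_list G ! j} \<in> edges G then 1 else 0)"

definition degree_matrix :: "'a ugraph \<Rightarrow> real mat" where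
  "degree_matrix G = mat (card (verts G)) (card (verts G))
     (\<lambda>(i, j). if i = j then real (vdegree G (vertex_list G ! i)) else 0)"

definition laplacian_matrix :: "'a ugraph \<Rightarrow> real mat" where
  "laplacian_matrix G = degree_matrix G - adjacency_matrix G"

text \<open>
  The eigenvalues with algebraic multiplicity. The Laplacian matrix is real symmetric, so all its
  eigenvalues are real and the multiset has as many elements as the graph has vertices.
\<close>

definition laplacian_spectrum :: "'a ugraph \<Rightarrow> real multiset" where
  "laplacian_spectrum G = proots (char_poly (laplacian_matrix G))"

definition laplacian_eigenvalues_desc :: "'a ugraph \<Rightarrow> real list" where
  "laplacian_eigenvalues_desc G = rev (sorted_list_of_multiset (laplacian_spectrum G))"

definition sum_largest :: "nat \<Rightarrow> 'a ugraph \<Rightarrow> real" where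
  "sum_largest k G = sum_list (take k (laplacian_eigenvalues_desc G))"

definition laplacian_energy :: "'a ugraph \<Rightarrow> real" where
  "laplacian_energy G = (\<Sum>\<mu> \<in># laplacian_spectrum G. \<bar>\<mu> - avg_degree G\<bar>)"

definition count_eigenvalues_ge :: "real \<Rightarrow> 'a ugraph \<Rightarrow> nat" where
  "count_eigenvalues_ge c G = size {#\<mu> \<in># laplacian_spectrum G. \<mu> \<ge> c#}"

end

theory Submission
  imports Defs "Jordan_Normal_Form.Schur_Decomposition"
begin

text \<open>
  The Laplacian eigenvalues sum to \<open>2 m = n d\<close>, where \<open>d\<close> is the average degree, so the Laplacian energy
  of \<open>T\<close> equals \<open>2 \<Sum> max 0 (\<mu> - d)\<close>. Deleting an edge decreases the Laplacian matrix in the positive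
  semidefinite order; hence, as in Ky Fan's principle, this sum is at least \<open>2 \<Sum> (\<mu> - d)\<close> over
  any set of eigenvalues of \<open>T - e\<close>. Take those that are at least the average degree of \<open>T - e\<close>. The spectrum of
  \<open>T - e\<close> is the union of the spectra of its two components, and \<open>d = 2 - 2/n\<close> because a tree has
  \<open>n - 1\<close> edges.
\<close>

section \<open>Real symmetric matrices\<close>

text \<open>Over the complex numbers the characteristic polynomial splits, and each root has an
  eigenvector. Its Hermitian form is real by symmetry, which forces the root to be real.\<close>

lemma symmetric_char_poly_splits:
  fixes A :: "real mat"
  assumes A: "A \<in> carrier_mat n n" and sym: "A\<^sup>T = A"
  obtains es where "char_poly A = (\<Prod>e\<leftarrow>es. [:- e, 1:])"
proof -
  let ?C = "map_mat complex_of_real A"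
  have C: "?C \<in> carrier_mat n n" using A by simp
  have entry: "A $$ (i, j) = A $$ (j, i)" if "i < n" "j < n" for i j
    using that A arg_cong[OF sym, of "\<lambda>M. M $$ (i, j)"] by simp
  obtain as where as: "char_poly ?C = (\<Prod>a\<leftarrow>as. [:- a, 1:])"
    using char_poly_factorized[OF C] by blast
  have "complex_of_real (Re a) = a" if a: "a \<in> set as" for a
  proof -
    have "poly (char_poly ?C) a = 0"
      unfolding as poly_prod_list using a by (force simp: prod_list_zero_iff)
    then have "eigenvalue ?C a" using eigenvalue_root_char_poly[OF C] by simp
    then obtain v where v: "v \<in> carrier_vec n" "v \<noteq> 0\<^sub>v n" "?C *\<^sub>v v = a \<cdot>\<^sub>v v"
      unfolding eigenvalue_def eigenvector_def using A by auto
    have row: "(\<Sum>j<n. of_real (A $$ (i, j)) * v $ j) = a * v $ i" if "i < n" for i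
      using arg_cong[OF v(3), of "\<lambda>w. w $ i"] that v(1) A
      by (simp add: scalar_prod_def atLeast0LessThan)
    \<comment> \<open>\<open>q\<close> is the Hermitian form of the eigenvector and \<open>s\<close>
      its squared norm. Both are real, \<open>q = a * s\<close> and \<open>s\<close> is nonzero, so
      \<open>a\<close> is real.\<close>
    define q where "q = (\<Sum>i<n. \<Sum>j<n. of_real (A $$ (i, j)) * v $ j * cnj (v $ i))"
    define s where "s = (\<Sum>i<n. v $ i * cnj (v $ i))"
    have "q = a * s"
      unfolding q_def s_def sum_distrib_left
      by (rule sum.cong, simp) (simp add: row sum_distrib_right[symmetric] mult.assoc[symmetric])
    \<comment> \<open>Conjugation exchanges the two summation indices, and \<open>A\<close> is real
      and symmetric.\<close>
    moreover have "cnj q = q"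
      unfolding q_def cnj_sum
      by (subst sum.swap) (auto intro!: sum.cong simp: entry)
    moreover have "cnj s = s" unfolding s_def by (simp add: mult.commute)
    moreover have "s \<noteq> 0"
    proof -
      have "s = of_real (\<Sum>i<n. (cmod (v $ i))\<^sup>2)"
        unfolding s_def by (simp only: complex_norm_square of_real_sum)
      moreover obtain i where "i < n" "v $ i \<noteq> 0"
        using v(1,2) by (metis carrier_vecD eq_vecI index_zero_vec)
      then have "(\<Sum>i<n. (cmod (v $ i))\<^sup>2) > 0"
        by (intro sum_pos2[where i = i]) auto
      ultimately show ?thesis by (metis less_irrefl of_real_eq_0_iff)
    qed
    ultimately have "cnj a = a" by (metis complex_cnj_mult mult_right_cancel)
    then show ?thesis by (metis complex_eqI complex_cnj Reals_cnj_iff of_real_Re)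
  qed
  then have as': "map complex_of_real (map Re as) = as" by (simp add: map_idI)
  \<comment> \<open>Real polynomials embed injectively into complex ones, so the factorization
    descends to the reals.\<close>
  interpret h: map_poly_inj_idom_hom complex_of_real ..
  have "map_poly complex_of_real (char_poly A) = (\<Prod>a\<leftarrow>map complex_of_real (map Re as). [:- a, 1:])"
    unfolding as' as[symmetric] of_real_hom.char_poly_hom[OF A] ..
  also have "\<dots> = map_poly complex_of_real (\<Prod>e\<leftarrow>map Re as. [:- e, 1:])"
    by (simp add: h.hom_prod_list o_def)
  finally have "char_poly A = (\<Prod>e\<leftarrow>map Re as. [:- e, 1:])" by (rule h.injectivity)
  then show ?thesis by (rule that)
qed

text \<open>Extend \<open>v\<close> to a basis, orthogonalize starting from \<open>v\<close>, and
  normalize. The factor \<open>c\<close> is harmless later, since nonzero multiples of an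
  eigenvector are eigenvectors.\<close>

lemma orthogonal_completion:
  fixes v :: "real vec"
  assumes v: "v \<in> carrier_vec n" and v0: "v \<noteq> 0\<^sub>v n"
  obtains W c where "W \<in> carrier_mat n n" "W\<^sup>T * W = 1\<^sub>m n" "col W 0 = c \<cdot>\<^sub>v v"
proof -
  interpret cof_vec_space n "TYPE(real)" .
  define b where "b = basis_completion v"
  define ws where "ws = gram_schmidt n b"
  define N where "N = map (\<lambda>w. (1 / sqrt (w \<bullet> w)) \<cdot>\<^sub>v w) ws"
  define W where "W = mat_of_cols n N"
  from basis_completion[OF v v0, folded b_def]
  have dist_b: "distinct b" and indep: "\<not> lin_dep (set b)" and b: "set b \<subseteq> carrier_vec n"
    and hdb: "hd b = v" and len_b: "length b = n" by auto
  have n: "n \<noteq> 0" using v v0 by auto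
  then obtain vs where bv: "b = v # vs" using hdb len_b by (cases b) auto
  from gram_schmidt_result[OF b dist_b indep refl, folded ws_def]
  have ws: "set ws \<subseteq> carrier_vec n" and orth: "corthogonal ws" and len: "length ws = n"
    by (auto simp: len_b)
  \<comment> \<open>Gram-Schmidt leaves the first vector unchanged.\<close>
  have hdws: "ws ! 0 = v"
    using gram_schmidt_hd[OF v, of vs, folded bv, folded ws_def] len n
    by (cases ws) auto
  have wi: "ws ! i \<in> carrier_vec n" if "i < n" for i using ws len that by auto
  have W: "W \<in> carrier_mat n n"
    unfolding W_def N_def using len mat_of_cols_carrier(1)[of n N] by (simp add: N_def)
  have colW: "col W i = (1 / sqrt (ws ! i \<bullet> ws ! i)) \<cdot>\<^sub>v ws ! i" if "i < n" for i
    unfolding W_def N_def using len wi[OF that] that by (subst col_mat_of_cols) auto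
  have "W\<^sup>T * W = 1\<^sub>m n"
  proof (rule eq_matI)
    fix i j assume "i < dim_row (1\<^sub>m n :: real mat)" "j < dim_col (1\<^sub>m n :: real mat)"
    then have i: "i < n" and j: "j < n" by auto
    \<comment> \<open>\<open>corthogonal\<close> also excludes zero vectors, so the normalizing
      square roots do not vanish.\<close>
    have o: "ws ! i \<bullet> ws ! j = 0 \<longleftrightarrow> i \<noteq> j"
      using corthogonalD[OF orth, of i j] i j len by simp
    have "(W\<^sup>T * W) $$ (i, j) = col W i \<bullet> col W j" using W i j by simp
    also have "\<dots> = (1 / sqrt (ws ! i \<bullet> ws ! i)) * ((1 / sqrt (ws ! j \<bullet> ws ! j)) * (ws ! i \<bullet> ws ! j))"
      unfolding colW[OF i] colW[OF j]
      using wi[OF i] wi[OF j] by simp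
    also have "\<dots> = 1\<^sub>m n $$ (i, j)"
    proof (cases "i = j")
      case True
      moreover have "ws ! i \<bullet> ws ! i \<ge> 0" by (simp add: scalar_prod_def sum_nonneg)
      ultimately show ?thesis using o i by simp
    qed (use o i j in simp)
    finally show "(W\<^sup>T * W) $$ (i, j) = 1\<^sub>m n $$ (i, j)" .
  qed (use W in auto)
  moreover have "col W 0 = (1 / sqrt (v \<bullet> v)) \<cdot>\<^sub>v v" using colW[of 0] n hdws by simp
  ultimately show ?thesis using that W by blast
qed

text \<open>Deflation: an orthogonal change of basis moves an eigenvector for the first listed
  eigenvalue to the first coordinate, leaving a smaller symmetric matrix with the remaining
  eigenvalues. Prescribing the list \<open>es\<close> lets later sums run over its positions,
  multiplicities included.\<close>

lemma real_symmetric_diagonalization: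
  fixes A :: "real mat"
  assumes "A \<in> carrier_mat n n" and "A\<^sup>T = A"
    and "char_poly A = (\<Prod>e\<leftarrow>es. [:- e, 1:])"
  shows "\<exists>U \<in> carrier_mat n n. U\<^sup>T * U = 1\<^sub>m n \<and> U\<^sup>T * A * U = mat_diag n ((!) es)"
  using assms
proof (induction es arbitrary: n A)
  case Nil
  then have "n = 0" using degree_monic_char_poly[of A n] by simp
  then show ?case using Nil by (intro bexI[of _ "1\<^sub>m n"]) (auto simp: mat_diag_def)
next
  case (Cons e es n A)
  note A = Cons.prems(1) and sym = Cons.prems(2) and cp = Cons.prems(3)
  define m where "m = n - 1"
  have "monic (\<Prod>e\<leftarrow>es. [:- e, 1:])" by (rule monic_prod_list) auto
  then have "degree (char_poly A) = Suc (degree (\<Prod>e\<leftarrow>es. [:- e, 1:]))"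
    unfolding cp by (simp del: mult_pCons_left, subst degree_mult_eq) auto
  then have n: "n = Suc m" using degree_monic_char_poly[OF A] m_def by simp
  have "eigenvalue A e" unfolding eigenvalue_root_char_poly[OF A] cp by simp
  then obtain v where v: "v \<in> carrier_vec n" "v \<noteq> 0\<^sub>v n" "A *\<^sub>v v = e \<cdot>\<^sub>v v"
    unfolding eigenvalue_def eigenvector_def using A by auto
  obtain W c where W: "W \<in> carrier_mat n n" and WW: "W\<^sup>T * W = 1\<^sub>m n" and W0: "col W 0 = c \<cdot>\<^sub>v v"
    using orthogonal_completion[OF v(1,2)] .
  have WW': "W * W\<^sup>T = 1\<^sub>m n" using mat_mult_left_right_inverse[OF _ _ WW] W by simp
  define A' where "A' = W\<^sup>T * A * W"
  have A': "A' \<in> carrier_mat n n" unfolding A'_def using A W by simp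
  have sym': "A'\<^sup>T = A'"
    unfolding A'_def using A W sym
    by (simp add: transpose_mult[of _ n n _ n] assoc_mult_mat[of _ n n _ n _ n])
  have symA': "A' $$ (i, j) = A' $$ (j, i)" if "i < n" "j < n" for i j
    using that A' arg_cong[OF sym', of "\<lambda>M. M $$ (i, j)"] by simp
  \<comment> \<open>Column 0 of \<open>W\<close> is an eigenvector for \<open>e\<close>, so column 0
    of \<open>A'\<close> is \<open>e\<close> times column 0 of
    \<open>W\<^sup>T * W = 1\<close>.\<close>
  have col0: "A' $$ (i, 0) = (if i = 0 then e else 0)" if i: "i < n" for i
  proof -
    have "A' = W\<^sup>T * (A * W)" unfolding A'_def using A W by (simp add: assoc_mult_mat[of _ n n _ n _ n])
    then have "A' $$ (i, 0) = col W i \<bullet> col (A * W) 0"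
      using i n W A by simp
    also have "col (A * W) 0 = A *\<^sub>v col W 0" using n by (intro col_mult2[OF A W]) simp
    also have "\<dots> = e \<cdot>\<^sub>v col W 0" unfolding W0 using A v
      by (simp add: mult_mat_vec smult_smult_assoc mult.commute)
    also have "col W i \<bullet> \<dots> = e * (W\<^sup>T * W) $$ (i, 0)" using W i n by simp
    finally show ?thesis unfolding WW using i n by simp
  qed
  define A3 where "A3 = mat m m (\<lambda>(i, j). A' $$ (Suc i, Suc j))"
  define A1 where "A1 = mat 1 1 (\<lambda>_. e)"
  have A3: "A3 \<in> carrier_mat m m" and A1: "A1 \<in> carrier_mat 1 1" unfolding A3_def A1_def by auto
  \<comment> \<open>By symmetry the first row vanishes off the diagonal together with the first
    column.\<close>
  have block: "A' = four_block_mat A1 (0\<^sub>m 1 m) (0\<^sub>m m 1) A3"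
    by (rule eq_matI) (use A' n col0 symA' in \<open>auto simp: A1_def A3_def\<close>)
  have "A3\<^sup>T = A3" by (rule eq_matI) (use symA' n in \<open>auto simp: A3_def\<close>)
  moreover have "char_poly A3 = (\<Prod>e\<leftarrow>es. [:- e, 1:])"
  proof -
    have "similar_mat_wit A' A W\<^sup>T W"
      by (rule similar_mat_witI[of _ _ n]) (use W A A' WW WW' A'_def in auto)
    then have "char_poly A' = char_poly A" using char_poly_similar similar_mat_def by blast
    moreover have "char_poly A' = char_poly A1 * char_poly A3"
      unfolding block by (rule char_poly_four_block_zeros_col[OF A1 _ A3]) simp
    moreover have "char_poly A1 = [:- e, 1:]"
      by (simp add: A1_def char_poly_defs det_def sign_def)
    \<comment> \<open>Cancelling the linear factor of \<open>e\<close> gives \<open>A3\<close> the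
      factorization that the induction hypothesis asks for.\<close>
    ultimately have "[:- e, 1:] * char_poly A3 = [:- e, 1:] * (\<Prod>e\<leftarrow>es. [:- e, 1:])"
      using cp by simp
    then show ?thesis by (metis mult_cancel_left pCons_eq_0_iff zero_neq_one)
  qed
  ultimately obtain U where U: "U \<in> carrier_mat m m" "U\<^sup>T * U = 1\<^sub>m m" "U\<^sup>T * A3 * U = mat_diag m ((!) es)"
    using Cons.IH[OF A3] by blast
  \<comment> \<open>\<open>F\<close> fixes the first coordinate and lets \<open>U\<close> act on the
    others; \<open>W * F\<close> is the required orthogonal matrix.\<close>
  define F where "F = four_block_mat (1\<^sub>m 1) (0\<^sub>m 1 m) (0\<^sub>m m 1) U"
  have F: "F \<in> carrier_mat n n" unfolding F_def using U n by auto
  have FT: "F\<^sup>T = four_block_mat (1\<^sub>m 1) (0\<^sub>m 1 m) (0\<^sub>m m 1) U\<^sup>T"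
    unfolding F_def using U by (subst transpose_four_block_mat[of _ 1 1 _ m _ m]) auto
  have FF: "F\<^sup>T * F = 1\<^sub>m n"
    unfolding FT unfolding F_def n
    by (subst mult_four_block_mat[of _ 1 1 _ m _ m _ _ 1 _ m]) (use U in auto)
  have "F\<^sup>T * A' = four_block_mat A1 (0\<^sub>m 1 m) (0\<^sub>m m 1) (U\<^sup>T * A3)"
    unfolding FT block
    by (subst mult_four_block_mat[of _ 1 1 _ m _ m _ _ 1 _ m]) (use U A1 A3 in auto)
  then have "F\<^sup>T * A' * F = four_block_mat A1 (0\<^sub>m 1 m) (0\<^sub>m m 1) (mat_diag m ((!) es))"
    unfolding F_def
    by (simp, subst mult_four_block_mat[of _ 1 1 _ m _ m _ _ 1 _ m]) (use U A1 A3 in auto)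
  also have "\<dots> = mat_diag n ((!) (e # es))"
    by (rule eq_matI) (auto simp: A1_def n mat_diag_def nth_Cons split: nat.splits)
  finally have FAF: "F\<^sup>T * A' * F = mat_diag n ((!) (e # es))" .
  have "(W * F)\<^sup>T * (W * F) = F\<^sup>T * (W\<^sup>T * W) * F"
    using W F by (simp add: transpose_mult[of _ n n _ n] assoc_mult_mat[of _ n n _ n _ n])
  moreover have "(W * F)\<^sup>T * A * (W * F) = F\<^sup>T * A' * F"
    unfolding A'_def using W F A
    by (simp add: transpose_mult[of _ n n _ n] assoc_mult_mat[of _ n n _ n _ n])
  ultimately show ?case using W F WW FF FAF by (intro bexI[of _ "W * F"]) auto
qed

text \<open>In orthonormal eigenbases \<open>u\<^sub>i\<close> of \<open>A\<close> and \<open>v\<^sub>j\<close> of \<open>B\<close>, the matrix of squares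
  \<open>(v\<^sub>j \<bullet> u\<^sub>i)\<^sup>2\<close> is doubly stochastic, and
  \<open>as ! i = u\<^sub>i \<bullet> A u\<^sub>i \<le> u\<^sub>i \<bullet> B u\<^sub>i\<close> is an average of the eigenvalues of \<open>B\<close>.\<close>

lemma sum_eigenvalue_excess_le:
  fixes A B :: "real mat"
  assumes A: "A \<in> carrier_mat n n" "A\<^sup>T = A" and B: "B \<in> carrier_mat n n" "B\<^sup>T = B"
    and le: "\<And>x. x \<in> carrier_vec n \<Longrightarrow> x \<bullet> (A *\<^sub>v x) \<le> x \<bullet> (B *\<^sub>v x)"
    and cA: "char_poly A = (\<Prod>e\<leftarrow>as. [:- e, 1:])" and cB: "char_poly B = (\<Prod>e\<leftarrow>bs. [:- e, 1:])"
    and S: "S \<subseteq> {..<n}"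
  shows "(\<Sum>i\<in>S. as ! i - d) \<le> (\<Sum>j<n. max 0 (bs ! j - d))"
proof -
  obtain U where U: "U \<in> carrier_mat n n" "U\<^sup>T * U = 1\<^sub>m n" "U\<^sup>T * A * U = mat_diag n ((!) as)"
    using real_symmetric_diagonalization[OF A cA] by blast
  obtain V where V: "V \<in> carrier_mat n n" "V\<^sup>T * V = 1\<^sub>m n" "V\<^sup>T * B * V = mat_diag n ((!) bs)"
    using real_symmetric_diagonalization[OF B cB] by blast
  have UU: "U * U\<^sup>T = 1\<^sub>m n" using mat_mult_left_right_inverse[OF _ _ U(2)] U(1) by simp
  have VV: "V * V\<^sup>T = 1\<^sub>m n" using mat_mult_left_right_inverse[OF _ _ V(2)] V(1) by simp
  \<comment> \<open>Entry \<open>(j, i)\<close> of \<open>W\<close> is the inner product of column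
    \<open>j\<close> of \<open>V\<close> with column \<open>i\<close> of \<open>U\<close>.\<close>
  define W where "W = V\<^sup>T * U"
  have W: "W \<in> carrier_mat n n" unfolding W_def using U V by simp
  have "W\<^sup>T * W = U\<^sup>T * (V * V\<^sup>T) * U"
    unfolding W_def using U(1) V(1) by (simp add: transpose_mult[of _ n n _ n] assoc_mult_mat[of _ n n _ n _ n])
  then have WW: "W\<^sup>T * W = 1\<^sub>m n" using VV U by simp
  have WW': "W * W\<^sup>T = 1\<^sub>m n" using mat_mult_left_right_inverse[OF _ _ WW] W by simp
  have col_sum: "(\<Sum>j<n. (W $$ (j, i))\<^sup>2) = 1" if "i < n" for i
    using arg_cong[OF WW, of "\<lambda>M. M $$ (i, i)"] that W
    by (simp add: scalar_prod_def atLeast0LessThan power2_eq_square)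
  have row_sum: "(\<Sum>i<n. (W $$ (j, i))\<^sup>2) = 1" if "j < n" for j
    using arg_cong[OF WW', of "\<lambda>M. M $$ (j, j)"] that W
    by (simp add: scalar_prod_def atLeast0LessThan power2_eq_square)
  have quad: "(U\<^sup>T * M * U) $$ (i, i) = col U i \<bullet> (M *\<^sub>v col U i)"
    if "i < n" "M \<in> carrier_mat n n" for i M
  proof -
    have "U\<^sup>T * M * U = U\<^sup>T * (M * U)" using U that by (simp add: assoc_mult_mat[of _ n n _ n _ n])
    moreover have "col (M * U) i = M *\<^sub>v col U i" using col_mult2[OF that(2) U(1) that(1)] .
    ultimately show ?thesis using that U(1) by simp
  qed
  \<comment> \<open>Inserting \<open>V * V\<^sup>T = 1\<close> on both sides of \<open>B\<close>
    expresses its form in its own eigenbasis.\<close>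
  have "U\<^sup>T * B * U = U\<^sup>T * (V * V\<^sup>T) * B * (V * V\<^sup>T) * U" using VV U B by simp
  also have "\<dots> = W\<^sup>T * (V\<^sup>T * B * V) * W"
    unfolding W_def using U(1) V(1) B by (simp add: transpose_mult[of _ n n _ n] assoc_mult_mat[of _ n n _ n _ n])
  finally have UBU: "U\<^sup>T * B * U = W\<^sup>T * mat_diag n ((!) bs) * W" unfolding V(3) .
  have main: "as ! i \<le> (\<Sum>j<n. bs ! j * (W $$ (j, i))\<^sup>2)" if i: "i < n" for i
  proof -
    have "as ! i = (U\<^sup>T * A * U) $$ (i, i)" unfolding U(3) using i by (simp add: mat_diag_def)
    also have "\<dots> = col U i \<bullet> (A *\<^sub>v col U i)" using quad[OF i A(1)] .
    also have "\<dots> \<le> col U i \<bullet> (B *\<^sub>v col U i)" using U(1) i by (intro le) simp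
    also have "\<dots> = (W\<^sup>T * mat_diag n ((!) bs) * W) $$ (i, i)" using quad[OF i B(1)] UBU by simp
    also have "\<dots> = (\<Sum>j<n. bs ! j * (W $$ (j, i))\<^sup>2)"
      using W i
      by (simp add: mat_diag_mult_right[of _ n n] scalar_prod_def atLeast0LessThan power2_eq_square ac_simps)
    finally show ?thesis .
  qed
  have "(\<Sum>i\<in>S. as ! i - d) \<le> (\<Sum>i\<in>S. \<Sum>j<n. max 0 (bs ! j - d) * (W $$ (j, i))\<^sup>2)"
  proof (rule sum_mono)
    fix i assume "i \<in> S"
    then have i: "i < n" using S by auto
    \<comment> \<open>The squares in column \<open>i\<close> sum to 1, so \<open>d\<close> can be
      moved inside the average.\<close>
    have "as ! i - d \<le> (\<Sum>j<n. bs ! j * (W $$ (j, i))\<^sup>2) - d * (\<Sum>j<n. (W $$ (j, i))\<^sup>2)"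
      using main[OF i] col_sum[OF i] by simp
    also have "\<dots> = (\<Sum>j<n. (bs ! j - d) * (W $$ (j, i))\<^sup>2)"
      by (simp add: sum_distrib_left sum_subtractf left_diff_distrib)
    also have "\<dots> \<le> (\<Sum>j<n. max 0 (bs ! j - d) * (W $$ (j, i))\<^sup>2)"
      by (intro sum_mono mult_right_mono) auto
    finally show "as ! i - d \<le> (\<Sum>j<n. max 0 (bs ! j - d) * (W $$ (j, i))\<^sup>2)" .
  qed
  \<comment> \<open>Truncation at 0 makes all terms nonnegative, so \<open>S\<close> can be enlarged
    to all indices; then the row sums are 1.\<close>
  also have "\<dots> \<le> (\<Sum>i<n. \<Sum>j<n. max 0 (bs ! j - d) * (W $$ (j, i))\<^sup>2)"
    using S by (intro sum_mono2) (auto intro!: sum_nonneg)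
  also have "\<dots> = (\<Sum>j<n. max 0 (bs ! j - d) * (\<Sum>i<n. (W $$ (j, i))\<^sup>2))"
    by (subst sum.swap) (simp add: sum_distrib_left)
  also have "\<dots> = (\<Sum>j<n. max 0 (bs ! j - d))" by (simp add: row_sum)
  finally show ?thesis .
qed

section \<open>Matrices of a kernel over a list of vertices\<close>

definition kernel_mat :: "('a \<Rightarrow> 'a \<Rightarrow> 'b) \<Rightarrow> 'a list \<Rightarrow> 'b mat" where
  "kernel_mat f xs = mat (length xs) (length xs) (\<lambda>(i, j). f (xs ! i) (xs ! j))"

lemma kernel_mat_carrier [simp]: "kernel_mat f xs \<in> carrier_mat (length xs) (length xs)"
  by (simp add: kernel_mat_def)

lemma kernel_mat_index [simp]:
  "i < length xs \<Longrightarrow> j < length xs \<Longrightarrow> kernel_mat f xs $$ (i, j) = f (xs ! i) (xs ! j)"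
  by (simp add: kernel_mat_def)

lemma kernel_mat_cong:
  "(\<And>u v. u \<in> set xs \<Longrightarrow> v \<in> set xs \<Longrightarrow> f u v = g u v) \<Longrightarrow> kernel_mat f xs = kernel_mat g xs"
  by (auto simp: kernel_mat_def intro!: eq_matI)

lemma transpose_kernel_mat: "(\<And>u v. f u v = f v u) \<Longrightarrow> (kernel_mat f xs)\<^sup>T = kernel_mat f xs"
  by (auto simp: kernel_mat_def intro!: eq_matI)

text \<open>The two matrices are conjugate by the permutation matrix of \<open>p\<close>, which
  sends a position in \<open>xs\<close> to the position of the same vertex in
  \<open>ys\<close>.\<close>

lemma char_poly_kernel_mat_permute:
  fixes f :: "'a \<Rightarrow> 'a \<Rightarrow> real"
  assumes "distinct xs" "distinct ys" "set xs = set ys"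
  shows "char_poly (kernel_mat f xs) = char_poly (kernel_mat f ys)"
proof -
  define n where "n = length ys"
  have n: "length xs = n" "length ys = n" using assms distinct_card by (metis n_def)+
  have "\<exists>j<n. ys ! j = xs ! i" if "i < n" for i
    using that n assms(3) by (metis in_set_conv_nth)
  then obtain p where p: "p i < n" "ys ! p i = xs ! i" if "i < n" for i by metis
  have inj: "p i = p j \<longleftrightarrow> i = j" if "i < n" "j < n" for i j
    using p that assms(1) n by (metis nth_eq_iff_index_eq)
  define P :: "real mat" where "P = mat n n (\<lambda>(i, j). if j = p i then 1 else 0)"
  have P: "P \<in> carrier_mat n n" by (simp add: P_def)
  have Y: "kernel_mat f ys \<in> carrier_mat n n" using kernel_mat_carrier n by metis
  have X: "kernel_mat f xs \<in> carrier_mat n n" using kernel_mat_carrier n by metis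
  have PP: "P * P\<^sup>T = 1\<^sub>m n"
    by (rule eq_matI) (auto simp: P_def scalar_prod_def p inj if_distrib[of "\<lambda>x. x * _"] cong: if_cong)
  then have PP': "P\<^sup>T * P = 1\<^sub>m n" using mat_mult_left_right_inverse[of P n "P\<^sup>T"] P by simp
  have PY: "(P * kernel_mat f ys) = mat n n (\<lambda>(i, j). f (xs ! i) (ys ! j))"
    by (rule eq_matI)
      (use Y n in \<open>auto simp: P_def scalar_prod_def p if_distrib[of "\<lambda>x. x * _"] kernel_mat_def cong: if_cong\<close>)
  have "P * kernel_mat f ys * P\<^sup>T = kernel_mat f xs"
    unfolding PY
    by (rule eq_matI)
      (use X n in \<open>auto simp: P_def scalar_prod_def p if_distrib[of "\<lambda>x. _ * x"] kernel_mat_def cong: if_cong\<close>)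
  then have "similar_mat_wit (kernel_mat f xs) (kernel_mat f ys) P P\<^sup>T"
    by (intro similar_mat_witI[of _ _ n]) (use PP PP' P X Y in auto)
  then show ?thesis using char_poly_similar similar_mat_def by blast
qed

text \<open>Both off-diagonal blocks vanish, one by \<open>cross\<close> and the other by
  \<open>cross\<close> and symmetry.\<close>

lemma char_poly_kernel_mat_append:
  fixes f :: "'a \<Rightarrow> 'a \<Rightarrow> real"
  assumes sym: "\<And>u v. f u v = f v u" and cross: "\<And>u v. u \<in> set xs \<Longrightarrow> v \<in> set ys \<Longrightarrow> f u v = 0"
  shows "char_poly (kernel_mat f (xs @ ys)) = char_poly (kernel_mat f xs) * char_poly (kernel_mat f ys)"
proof -
  let ?n = "length xs" and ?m = "length ys"
  let ?B = "four_block_mat (kernel_mat f xs) (0\<^sub>m ?n ?m) (0\<^sub>m ?m ?n) (kernel_mat f ys)"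
  have block: "kernel_mat f (xs @ ys) = ?B"
  proof (rule eq_matI)
    fix i j
    assume "i < dim_row ?B" "j < dim_col ?B"
    then have "i < ?n + ?m" "j < ?n + ?m" by (auto simp: kernel_mat_def)
    then show "kernel_mat f (xs @ ys) $$ (i, j) = ?B $$ (i, j)"
      using cross sym by (auto simp: kernel_mat_def nth_append)
  qed (auto simp: kernel_mat_def)
  \<comment> \<open>The product rule for block matrices applied below asks for diagonal blocks whose
    characteristic polynomials split; symmetry provides this over the reals.\<close>
  have splits: "\<exists>es. char_poly (kernel_mat f zs) = (\<Prod>e\<leftarrow>es. [:- e, 1:])" for zs
    by (rule symmetric_char_poly_splits[OF kernel_mat_carrier transpose_kernel_mat[of f zs, OF sym]]) blast
  show ?thesis
    by (rule char_poly_0_block[OF block splits splits kernel_mat_carrier zero_carrier_mat kernel_mat_carrier])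
qed

lemma quadratic_form_kernel_mat:
  fixes f :: "'a \<Rightarrow> 'a \<Rightarrow> real"
  assumes "x \<in> carrier_vec (length xs)"
  shows "x \<bullet> (kernel_mat f xs *\<^sub>v x) =
    (\<Sum>i<length xs. \<Sum>j<length xs. f (xs ! i) (xs ! j) * (x $ i * x $ j))"
  using assms
  by (auto simp: scalar_prod_def kernel_mat_def atLeast0LessThan sum_distrib_left intro!: sum.cong)

text \<open>Expand the diagonal of \<open>U\<^sup>T * A * U\<close> as a triple sum and sum over the
  column index of \<open>U\<close> first: orthonormality of its rows leaves only the diagonal
  entries of \<open>A\<close>.\<close>

lemma sum_eigenvalues_eq_trace:
  fixes A :: "real mat"
  assumes A: "A \<in> carrier_mat n n" "A\<^sup>T = A" and c: "char_poly A = (\<Prod>e\<leftarrow>es. [:- e, 1:])"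
  shows "(\<Sum>i<n. es ! i) = (\<Sum>i<n. A $$ (i, i))"
proof -
  obtain U where U: "U \<in> carrier_mat n n" "U\<^sup>T * U = 1\<^sub>m n" "U\<^sup>T * A * U = mat_diag n ((!) es)"
    using real_symmetric_diagonalization[OF A c] by blast
  have UU: "U * U\<^sup>T = 1\<^sub>m n" using mat_mult_left_right_inverse[OF _ _ U(2)] U(1) by simp
  have orth: "(\<Sum>i<n. U $$ (k, i) * U $$ (l, i)) = (if k = l then 1 else 0)" if "k < n" "l < n" for k l
    using arg_cong[OF UU, of "\<lambda>M. M $$ (k, l)"] that U(1)
    by (simp add: scalar_prod_def atLeast0LessThan)
  have "(\<Sum>i<n. es ! i) = (\<Sum>i<n. (U\<^sup>T * A * U) $$ (i, i))"
    unfolding U(3) by (simp add: mat_diag_def)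
  also have "\<dots> = (\<Sum>i<n. \<Sum>k<n. \<Sum>l<n. A $$ (k, l) * (U $$ (k, i) * U $$ (l, i)))"
    using U(1) A(1)
    by (auto simp: scalar_prod_def atLeast0LessThan sum_distrib_left assoc_mult_mat[of _ n n _ n _ n]
      ac_simps intro!: sum.cong)
  also have "\<dots> = (\<Sum>k<n. \<Sum>i<n. \<Sum>l<n. A $$ (k, l) * (U $$ (k, i) * U $$ (l, i)))"
    by (rule sum.swap)
  also have "\<dots> = (\<Sum>k<n. \<Sum>l<n. \<Sum>i<n. A $$ (k, l) * (U $$ (k, i) * U $$ (l, i)))"
    by (rule sum.cong[OF refl], rule sum.swap)
  also have "\<dots> = (\<Sum>k<n. \<Sum>l<n. A $$ (k, l) * (if k = l then 1 else 0))"
    by (simp add: sum_distrib_left[symmetric] orth)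
  also have "\<dots> = (\<Sum>i<n. A $$ (i, i))"
    by (simp add: if_distrib[of "\<lambda>x. _ * x"] cong: if_cong)
  finally show ?thesis .
qed

section \<open>Laplacian spectra\<close>

text \<open>Links spectra, which are multisets, to diagonalizations, where eigenvalues carry
  positions.\<close>

lemma sum_mset_filter_mset_nth:
  "(\<Sum>x\<in>#filter_mset P (mset xs). g x) = (\<Sum>i\<in>{i. i < length xs \<and> P (xs ! i)}. g (xs ! i))"
proof -
  have "mset xs = image_mset ((!) xs) (mset_set {..<length xs})"
    by (metis atLeast0LessThan map_nth mset_map mset_upt)
  then have "filter_mset P (mset xs) = image_mset ((!) xs) (mset_set {i. i < length xs \<and> P (xs ! i)})"
    by (simp add: filter_mset_image_mset filter_mset_mset_set Collect_conj_eq lessThan_def)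
  then show ?thesis by (simp add: sum_unfold_sum_mset image_mset.compositionality o_def)
qed

text \<open>In a descending list the entries at or above a threshold form a prefix.\<close>

lemma take_filter_ge_sorted_desc:
  "sorted_wrt (\<ge>) xs \<Longrightarrow> take (length (filter (\<lambda>x. x \<ge> c) xs)) xs = filter (\<lambda>x. x \<ge> c) xs"
  for c :: "'a :: linorder"
proof (induction xs)
  case (Cons x xs)
  show ?case
  proof (cases "x \<ge> c")
    case False
    then have "filter (\<lambda>x. x \<ge> c) xs = []"
      using Cons.prems by (auto simp: filter_empty_conv)
    then show ?thesis using False by simp
  qed (use Cons in simp)
qed simp

text \<open>Replaces the order-dependent sum of the largest eigenvalues by one that is additive over
  unions of spectra.\<close>

lemma sum_largest_count_eigenvalues_ge:
  "sum_largest (count_eigenvalues_ge c G) G = \<Sum>\<^sub># {#\<mu> \<in># laplacian_spectrum G. \<mu> \<ge> c#}"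
proof -
  let ?xs = "laplacian_eigenvalues_desc G"
  have m: "mset ?xs = laplacian_spectrum G" by (simp add: laplacian_eigenvalues_desc_def)
  have "sorted_wrt (\<ge>) ?xs"
    by (simp add: laplacian_eigenvalues_desc_def sorted_wrt_rev)
  then have "take (count_eigenvalues_ge c G) ?xs = filter (\<lambda>x. x \<ge> c) ?xs"
    using take_filter_ge_sorted_desc[of ?xs c]
    by (simp add: count_eigenvalues_ge_def m[symmetric] mset_filter[symmetric] del: mset_filter)
  then show ?thesis
    by (simp add: sum_largest_def m[symmetric] mset_filter[symmetric] sum_mset_sum_list del: mset_filter)
qed

text \<open>Entries depend on vertices instead of positions, so graphs with different vertex
  enumerations can be compared entrywise.\<close>

definition laplacian_kernel :: "'a ugraph \<Rightarrow> 'a \<Rightarrow> 'a \<Rightarrow> real" where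
  "laplacian_kernel G u v =
     (if u = v then real (vdegree G u) else 0) - (if {u, v} \<in> edges G then 1 else 0)"

lemma laplacian_kernel_commute: "laplacian_kernel G u v = laplacian_kernel G v u"
  by (simp add: laplacian_kernel_def insert_commute)

lemma vertex_list:
  assumes "finite (verts G)"
  shows "distinct (vertex_list G)" "set (vertex_list G) = verts G" "length (vertex_list G) = card (verts G)"
proof -
  have "distinct (vertex_list G) \<and> set (vertex_list G) = verts G"
    unfolding vertex_list_def by (rule someI_ex) (use finite_distinct_list[OF assms] in blast)
  then show "distinct (vertex_list G)" "set (vertex_list G) = verts G" by simp_all
  then show "length (vertex_list G) = card (verts G)" using distinct_card by metis
qed

lemma laplacian_matrix_eq_kernel_mat:
  assumes "finite (verts G)"
  shows "laplacian_matrix G = kernel_mat (laplacian_kernel G) (vertex_list G)"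
proof -
  note xs = vertex_list[OF assms]
  have "vertex_list G ! i = vertex_list G ! j \<longleftrightarrow> i = j" if "i < card (verts G)" "j < card (verts G)" for i j
    using that xs(1,3) nth_eq_iff_index_eq by metis
  then show ?thesis
    by (intro eq_matI) (simp_all add: laplacian_matrix_def degree_matrix_def adjacency_matrix_def
      kernel_mat_def laplacian_kernel_def xs(3))
qed

text \<open>Frees the spectrum from the choice in \<open>vertex_list\<close>, so that the vertices
  of one part can be listed before those of the other.\<close>

lemma char_poly_laplacian_matrix:
  assumes "finite (verts G)" "distinct xs" "set xs = verts G"
  shows "char_poly (laplacian_matrix G) = char_poly (kernel_mat (laplacian_kernel G) xs)"
  unfolding laplacian_matrix_eq_kernel_mat[OF assms(1)]
  by (rule char_poly_kernel_mat_permute) (simp_all add: vertex_list[OF assms(1)] assms(2,3))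

lemma laplacian_matrix_symmetric:
  assumes "finite (verts G)"
  shows "laplacian_matrix G \<in> carrier_mat (card (verts G)) (card (verts G))"
    and "(laplacian_matrix G)\<^sup>T = laplacian_matrix G"
  unfolding laplacian_matrix_eq_kernel_mat[OF assms] vertex_list(3)[OF assms, symmetric]
  by (rule kernel_mat_carrier, rule transpose_kernel_mat, rule laplacian_kernel_commute)

lemma proots_prod_linear_factors: "proots (\<Prod>e\<leftarrow>es. [:- e, 1:]) = mset es"
  for es :: "'a :: idom list"
proof (induction es)
  case (Cons e es)
  have "(\<Prod>e\<leftarrow>es. [:- e, 1:]) \<noteq> 0" by (auto simp: prod_list_zero_iff)
  then show ?case using Cons by (simp add: proots_mult del: mult_pCons_left)
qed simp

lemma laplacian_spectrum_list:
  assumes "finite (verts G)"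
  obtains es where "char_poly (laplacian_matrix G) = (\<Prod>e\<leftarrow>es. [:- e, 1:])"
    "laplacian_spectrum G = mset es" "length es = card (verts G)"
proof -
  note L = laplacian_matrix_symmetric[OF assms]
  obtain es where es: "char_poly (laplacian_matrix G) = (\<Prod>e\<leftarrow>es. [:- e, 1:])"
    using symmetric_char_poly_splits[OF L] .
  moreover have "laplacian_spectrum G = mset es"
    unfolding laplacian_spectrum_def es by (rule proots_prod_linear_factors)
  moreover have "length es = card (verts G)"
    using degree_monic_char_poly[OF L(1)] degree_linear_factors[of uminus es] es by simp
  ultimately show ?thesis by (rule that)
qed

text \<open>No edge crosses between the parts, so the Laplacian is block diagonal when one part is
  listed first, and its blocks are the Laplacians of the parts.\<close>

lemma laplacian_spectrum_disjoint_union: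
  assumes G: "simple_graph G" and U: "verts G = U\<^sub>1 \<union> U\<^sub>2" "U\<^sub>1 \<inter> U\<^sub>2 = {}"
    and split: "\<And>e. e \<in> edges G \<Longrightarrow> e \<subseteq> U\<^sub>1 \<or> e \<subseteq> U\<^sub>2"
  shows "laplacian_spectrum G =
    laplacian_spectrum (induced_subgraph G U\<^sub>1) + laplacian_spectrum (induced_subgraph G U\<^sub>2)"
proof -
  have fin: "finite (verts G)" using G by (simp add: simple_graph_def)
  have kernel: "laplacian_kernel G u v = laplacian_kernel (induced_subgraph G U) u v"
    if "U = U\<^sub>1 \<or> U = U\<^sub>2" "u \<in> U" "v \<in> U" for U u v
  proof -
    \<comment> \<open>An edge at \<open>u\<close> lies wholly in the part of \<open>u\<close>, so
      degrees survive the restriction.\<close>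
    have "{e \<in> edges G. u \<in> e} = {e \<in> edges (induced_subgraph G U). u \<in> e}"
      using that split U(2) by (fastforce simp: induced_subgraph_def)
    moreover have "{u, v} \<in> edges G \<longleftrightarrow> {u, v} \<in> edges (induced_subgraph G U)"
      using that by (auto simp: induced_subgraph_def)
    ultimately show ?thesis unfolding laplacian_kernel_def vdegree_def by presburger
  qed
  define H\<^sub>1 where "H\<^sub>1 = induced_subgraph G U\<^sub>1"
  define H\<^sub>2 where "H\<^sub>2 = induced_subgraph G U\<^sub>2"
  note H_def = H\<^sub>1_def H\<^sub>2_def
  have verts_H: "verts H\<^sub>1 = U\<^sub>1" "verts H\<^sub>2 = U\<^sub>2" by (auto simp: H_def induced_subgraph_def)
  have finH: "finite (verts H\<^sub>1)" "finite (verts H\<^sub>2)" using fin U(1) verts_H by auto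
  define xs ys where "xs = vertex_list H\<^sub>1" and "ys = vertex_list H\<^sub>2"
  note xs = vertex_list[OF finH(1), folded xs_def, unfolded verts_H]
  note ys = vertex_list[OF finH(2), folded ys_def, unfolded verts_H]
  have "char_poly (laplacian_matrix G) = char_poly (kernel_mat (laplacian_kernel G) (xs @ ys))"
    by (rule char_poly_laplacian_matrix[OF fin]) (use xs ys U in auto)
  also have "\<dots> = char_poly (kernel_mat (laplacian_kernel G) xs) * char_poly (kernel_mat (laplacian_kernel G) ys)"
  proof (rule char_poly_kernel_mat_append[OF laplacian_kernel_commute])
    fix u v assume "u \<in> set xs" "v \<in> set ys"
    then have "u \<in> U\<^sub>1" "v \<in> U\<^sub>2" using xs ys by auto
    then have "u \<noteq> v" "{u, v} \<notin> edges G" using U(2) split[of "{u, v}"] by auto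
    then show "laplacian_kernel G u v = 0" by (simp add: laplacian_kernel_def)
  qed
  also have "kernel_mat (laplacian_kernel G) xs = laplacian_matrix H\<^sub>1"
    unfolding laplacian_matrix_eq_kernel_mat[OF finH(1)] xs_def[symmetric]
    by (rule kernel_mat_cong) (use xs kernel[of "U\<^sub>1"] in \<open>auto simp: H_def\<close>)
  also have "kernel_mat (laplacian_kernel G) ys = laplacian_matrix H\<^sub>2"
    unfolding laplacian_matrix_eq_kernel_mat[OF finH(2)] ys_def[symmetric]
    by (rule kernel_mat_cong) (use ys kernel[of "U\<^sub>2"] in \<open>auto simp: H_def\<close>)
  finally have "char_poly (laplacian_matrix G) =
    char_poly (laplacian_matrix H\<^sub>1) * char_poly (laplacian_matrix H\<^sub>2)" .
  \<comment> \<open>\<open>proots\<close> is additive on products of nonzero polynomials;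
    characteristic polynomials are monic.\<close>
  moreover have "char_poly (laplacian_matrix H) \<noteq> 0" if "finite (verts H)" for H :: "'a ugraph"
    using degree_monic_char_poly[OF laplacian_matrix_symmetric(1)[OF that]] by auto
  ultimately show ?thesis
    using finH unfolding laplacian_spectrum_def H_def[symmetric] by (simp add: proots_mult)
qed

section \<open>Trace of the Laplacian and Laplacian energy\<close>

lemma sum_vdegree:
  assumes "simple_graph G"
  shows "(\<Sum>v\<in>verts G. vdegree G v) = 2 * card (edges G)"
proof -
  have fin: "finite (verts G)" and e: "\<And>e. e \<in> edges G \<Longrightarrow> e \<subseteq> verts G \<and> card e = 2"
    using assms by (auto simp: simple_graph_def)
  have "finite (edges G)" using e fin by (auto intro: finite_subset[of _ "Pow (verts G)"])
  \<comment> \<open>Double counting of incident pairs: every edge has two ends.\<close>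
  moreover have "card {v \<in> verts G. v \<in> e} = 2" if "e \<in> edges G" for e
    using e[OF that] by (metis Collect_conj_eq Collect_mem_eq inf.absorb2)
  ultimately show ?thesis
    unfolding vdegree_def using fin sum_multicount[of "verts G" "edges G" "\<lambda>v e. v \<in> e" 2] by simp
qed

text \<open>The sum of the eigenvalues is the trace, that is, the sum of the degrees.\<close>

lemma sum_laplacian_spectrum:
  assumes G: "simple_graph G"
  shows "\<Sum>\<^sub># (laplacian_spectrum G) = 2 * real (card (edges G))"
proof -
  have fin: "finite (verts G)" using G by (simp add: simple_graph_def)
  note xs = vertex_list[OF fin]
  obtain es where es: "char_poly (laplacian_matrix G) = (\<Prod>e\<leftarrow>es. [:- e, 1:])"
    "laplacian_spectrum G = mset es" "length es = card (verts G)"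
    using laplacian_spectrum_list[OF fin] .
  have loop: "{v, v} \<notin> edges G" for v
  proof
    assume "{v, v} \<in> edges G"
    then have "card {v, v} = 2" using G by (simp only: simple_graph_def)
    then show False by simp
  qed
  have "\<Sum>\<^sub># (laplacian_spectrum G) = (\<Sum>i<card (verts G). es ! i)"
    using es by (simp add: sum_mset_sum_list sum_list_sum_nth atLeast0LessThan)
  also have "\<dots> = (\<Sum>i<card (verts G). laplacian_matrix G $$ (i, i))"
    by (rule sum_eigenvalues_eq_trace[OF laplacian_matrix_symmetric[OF fin] es(1)])
  also have "\<dots> = (\<Sum>i<card (verts G). real (vdegree G (vertex_list G ! i)))"
    unfolding laplacian_matrix_eq_kernel_mat[OF fin]
    using loop xs(3) by (simp add: laplacian_kernel_def)
  also have "\<dots> = sum_list (map (\<lambda>v. real (vdegree G v)) (vertex_list G))"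
    using xs by (simp add: sum_list_sum_nth atLeast0LessThan)
  also have "\<dots> = real (\<Sum>v\<in>verts G. vdegree G v)"
    using xs by (simp add: sum_list_distinct_conv_sum_set)
  finally show ?thesis by (simp add: sum_vdegree[OF G])
qed

text \<open>Write \<open>|x|\<close> as \<open>2 * max 0 x - x\<close>; the deviations from the
  average degree sum to zero.\<close>

lemma laplacian_energy_eq:
  assumes G: "simple_graph G"
  shows "laplacian_energy G = 2 * (\<Sum>\<mu>\<in>#laplacian_spectrum G. max 0 (\<mu> - avg_degree G))"
proof (cases "verts G = {}")
  \<comment> \<open>Here the average degree is a quotient by zero, but the spectrum is empty and
    both sides vanish.\<close>
  case True
  then obtain es where "laplacian_spectrum G = mset es" "length es = 0"
    using laplacian_spectrum_list[of G] by auto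
  then show ?thesis by (simp add: laplacian_energy_def)
next
  case False
  have fin: "finite (verts G)" using G by (simp add: simple_graph_def)
  let ?S = "laplacian_spectrum G" and ?d = "avg_degree G"
  obtain es where "?S = mset es" "length es = card (verts G)"
    using laplacian_spectrum_list[OF fin] .
  then have size: "size ?S = card (verts G)" by simp
  have "(\<Sum>\<mu>\<in>#M. \<mu> - ?d) = \<Sum>\<^sub># M - real (size M) * ?d" for M
    by (induction M) (simp_all add: algebra_simps)
  note this[of ?S]
  also have "\<Sum>\<^sub># ?S - real (size ?S) * ?d = 0"
    unfolding size sum_laplacian_spectrum[OF G] using False fin by (simp add: avg_degree_def)
  finally have zero: "(\<Sum>\<mu>\<in>#?S. \<mu> - ?d) = 0" .
  have "(\<Sum>\<mu>\<in>#M. \<bar>\<mu> - ?d\<bar>) = 2 * (\<Sum>\<mu>\<in>#M. max 0 (\<mu> - ?d)) - (\<Sum>\<mu>\<in>#M. \<mu> - ?d)" for M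
    by (induction M) (simp_all add: max_def)
  note this[of ?S]
  then show ?thesis unfolding laplacian_energy_def zero by simp
qed

section \<open>Trees and edge deletion\<close>

lemma simple_graph_finite:
  assumes "simple_graph G"
  shows "finite (verts G)" "finite (edges G)"
  using assms by (auto simp: simple_graph_def intro: finite_subset[of _ "Pow (verts G)"])

lemma simple_graph_edgeE:
  assumes "simple_graph G" "e \<in> edges G" "v \<in> e"
  obtains w where "e = {v, w}" "v \<noteq> w" "v \<in> verts G" "w \<in> verts G"
proof -
  have e: "card e = 2" "e \<subseteq> verts G" using assms by (auto simp: simple_graph_def)
  then obtain x y where "e = {x, y}" "x \<noteq> y" by (auto simp: card_2_iff)
  then show ?thesis using that e assms(3) by (cases "v = x") (auto simp: insert_commute)
qed

text \<open>Breadth-first search from a root: the edges to the predecessors are pairwise distinct.\<close>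

lemma connected_card_verts_le:
  assumes G: "simple_graph G" and conn: "connected_graph G"
  shows "card (verts G) \<le> card (edges G) + 1"
proof -
  note fin = simple_graph_finite[OF G]
  obtain r where r: "r \<in> verts G" using conn by (auto simp: connected_graph_def)
  \<comment> \<open>Distance from the root; a predecessor of \<open>v\<close> is a neighbour of
    smaller depth.\<close>
  define depth where "depth v = (LEAST k. (r, v) \<in> adj_rel G ^^ k)" for v
  have "\<exists>u. {u, v} \<in> edges G \<and> depth u < depth v" if v: "v \<in> verts G - {r}" for v
  proof -
    have "(r, v) \<in> (adj_rel G)\<^sup>*" using conn r v by (auto simp: connected_graph_def)
    then obtain k where "(r, v) \<in> adj_rel G ^^ k" by (auto simp: rtrancl_power)
    then have *: "(r, v) \<in> adj_rel G ^^ depth v" unfolding depth_def by (rule LeastI)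
    then have "depth v \<noteq> 0" using v by (intro notI) auto
    then obtain m where m: "depth v = Suc m" by (cases "depth v") auto
    then obtain u where u: "(r, u) \<in> adj_rel G ^^ m" "(u, v) \<in> adj_rel G" using * by auto
    have "depth u \<le> m" unfolding depth_def using u(1) by (rule Least_le)
    then show ?thesis using u(2) m by (auto simp: adj_rel_def)
  qed
  then obtain p where p: "{p v, v} \<in> edges G" "depth (p v) < depth v" if "v \<in> verts G - {r}" for v
    by metis
  \<comment> \<open>If two different vertices shared an edge, each would be the predecessor of the
    other and have smaller depth.\<close>
  have "inj_on (\<lambda>v. {p v, v}) (verts G - {r})"
  proof (rule inj_onI)
    fix v w assume "v \<in> verts G - {r}" "w \<in> verts G - {r}" "{p v, v} = {p w, w}"
    then show "v = w" using p(2)[of v] p(2)[of w] by (auto simp: doubleton_eq_iff)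
  qed
  then have "card (verts G - {r}) \<le> card (edges G)"
    using p(1) fin by (intro card_inj_on_le) auto
  then show ?thesis using r fin by (simp add: card_Diff_singleton)
qed

text \<open>Consider the first vertex of a longest path: all its neighbours lie on the path, and a neighbour
  other than the second vertex would close a cycle.\<close>

lemma acyclic_ex_vdegree_le_1:
  assumes G: "simple_graph G" and acyclic: "\<nexists>c. is_cycle G c" and ne: "verts G \<noteq> {}"
  shows "\<exists>v\<in>verts G. vdegree G v \<le> 1"
proof -
  note fin = simple_graph_finite[OF G]
  define path where "path xs \<longleftrightarrow> xs \<noteq> [] \<and> distinct xs \<and> set xs \<subseteq> verts G \<and>
    (\<forall>i. Suc i < length xs \<longrightarrow> {xs ! i, xs ! Suc i} \<in> edges G)" for xs
  have bound: "length xs \<le> card (verts G)" if "path xs" for xs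
    using that fin unfolding path_def by (metis card_mono distinct_card)
  obtain x where "x \<in> verts G" using ne by auto
  then have "path [x]" by (simp add: path_def)
  \<comment> \<open>A longest path exists because path lengths are bounded by the number of
    vertices.\<close>
  then have "\<exists>xs. path xs \<and> (\<forall>ys. path ys \<longrightarrow> length ys \<le> length xs)"
    by (rule ex_has_greatest_nat[where b = "Suc (card (verts G))"]) (simp add: bound less_Suc_eq_le)
  then obtain xs where xs: "path xs" and longest: "\<And>ys. path ys \<Longrightarrow> length ys \<le> length xs"
    by auto
  obtain v zs where vzs: "xs = v # zs" using xs by (cases xs) (auto simp: path_def)
  have on_path: "\<exists>i\<le>1. i < length xs \<and> a = xs ! i" if a: "{v, a} \<in> edges G" for a
  proof -
    have av: "a \<noteq> v" "a \<in> verts G" using simple_graph_edgeE[OF G a, of a] by (auto simp: doubleton_eq_iff)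
    have "a \<in> set xs"
    proof (rule ccontr)
      assume "a \<notin> set xs"
      then have "path (a # xs)"
        using xs av a vzs by (auto simp: path_def nth_Cons insert_commute split: nat.splits)
      then show False using longest by fastforce
    qed
    then obtain k where k: "k < length xs" "a = xs ! k" by (auto simp: in_set_conv_nth)
    have "\<not> k \<ge> 2"
    proof
      assume "k \<ge> 2"
      \<comment> \<open>The initial segment from \<open>v\<close> to \<open>a\<close> is closed to a
        cycle by the edge between them.\<close>
      define c where "c = take (Suc k) xs"
      have len: "length c = Suc k" using k by (simp add: c_def)
      have "{c ! i, c ! (Suc i mod length c)} \<in> edges G" if i: "i < length c" for i
      proof (cases "i = k")
        case True
        moreover have "c ! k = a" using k by (simp add: c_def)
        moreover have "c ! 0 = v" using vzs by (simp add: c_def)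
        ultimately show ?thesis using a len by (simp add: insert_commute)
      next
        case False
        then have "Suc i < length c" using i len by simp
        then show ?thesis using xs k len by (simp add: c_def path_def)
      qed
      then have "is_cycle G c"
        using xs len \<open>k \<ge> 2\<close> by (simp add: is_cycle_def path_def c_def)
      then show False using acyclic by blast
    qed
    then show ?thesis using k by (intro exI[of _ k]) auto
  qed
  \<comment> \<open>On a one-vertex path \<open>xs ! 1\<close> is an unspecified value, but then no
    edge meets \<open>v\<close> and the inclusion holds.\<close>
  have "{e \<in> edges G. v \<in> e} \<subseteq> {{v, xs ! 1}}"
  proof
    fix e assume "e \<in> {e \<in> edges G. v \<in> e}"
    then have e: "e \<in> edges G" "v \<in> e" by auto
    then obtain a where a: "e = {v, a}" "v \<noteq> a" by (rule simple_graph_edgeE[OF G])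
    then obtain i where "i \<le> 1" "a = xs ! i" using on_path e by blast
    then have "i = 1" using a vzs by (cases i) auto
    then show "e \<in> {{v, xs ! 1}}" using a \<open>a = xs ! i\<close> by simp
  qed
  then have "vdegree G v \<le> card {{v, xs ! 1}}" unfolding vdegree_def by (intro card_mono) auto
  moreover have "v \<in> verts G" using xs vzs by (simp add: path_def)
  ultimately show ?thesis by auto
qed

text \<open>Removing a vertex of degree at most 1 keeps the graph acyclic and loses at most one
  edge, so induction on the number of vertices applies.\<close>

lemma acyclic_card_edges_less:
  assumes "simple_graph G" and "\<nexists>c. is_cycle G c" and "verts G \<noteq> {}"
  shows "card (edges G) < card (verts G)"
  using assms
proof (induction "card (verts G)" arbitrary: G rule: less_induct)
  case less
  note G = less.prems(1) and fin = simple_graph_finite[OF less.prems(1)]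
  obtain v where v: "v \<in> verts G" "vdegree G v \<le> 1"
    using acyclic_ex_vdegree_le_1[OF less.prems] by blast
  define H where "H = induced_subgraph G (verts G - {v})"
  have "edges G = edges H \<union> {e \<in> edges G. v \<in> e}"
    using G by (auto simp: H_def induced_subgraph_def simple_graph_def)
  then have "card (edges G) \<le> card (edges H) + vdegree G v"
    unfolding vdegree_def by (metis card_Un_le)
  then have le: "card (edges G) \<le> card (edges H) + 1" using v by simp
  have card_H: "card (verts G) = card (verts H) + 1"
    using card_Suc_Diff1[OF fin(1) v(1)] by (simp add: H_def induced_subgraph_def)
  show ?case
  proof (cases "verts H = {}")
    \<comment> \<open>The induction hypothesis covers nonempty graphs only, so a single vertex is
      treated directly.\<close>
    case True
    have "edges G = {}"
    proof (rule ccontr)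
      assume "edges G \<noteq> {}"
      then obtain e where "e \<in> edges G" by blast
      then have "card e = 2" "e \<subseteq> verts G" using G by (auto simp: simple_graph_def)
      then have "2 \<le> card (verts G)" using fin by (metis card_mono)
      then show False using card_H True by simp
    qed
    then show ?thesis using card_H by simp
  next
    case False
    have "simple_graph H" using G by (auto simp: simple_graph_def H_def induced_subgraph_def)
    moreover have "\<nexists>c. is_cycle H c"
      using less.prems(2) by (auto simp: is_cycle_def H_def induced_subgraph_def)
    ultimately have "card (edges H) < card (verts H)" using less.hyps[of H] card_H False by simp
    then show ?thesis using le card_H by simp
  qed
qed

text \<open>Connectedness bounds the number of edges from below, acyclicity from above.\<close>

lemma tree_card_edges:
  assumes "tree G"
  shows "card (edges G) + 1 = card (verts G)"
proof -
  have G: "simple_graph G" "connected_graph G" "\<nexists>c. is_cycle G c" using assms unfolding tree_def by blast+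
  then have "verts G \<noteq> {}" by (simp add: connected_graph_def)
  then show ?thesis
    using connected_card_verts_le[OF G(1,2)] acyclic_card_edges_less[OF G(1,3)] by linarith
qed

section \<open>Components and deletion of an edge\<close>

lemma two_components:
  assumes G: "simple_graph G" and comps: "components G = {H\<^sub>1, H\<^sub>2}" and ne: "H\<^sub>1 \<noteq> H\<^sub>2"
  obtains U\<^sub>1 U\<^sub>2 where "verts G = U\<^sub>1 \<union> U\<^sub>2" "U\<^sub>1 \<inter> U\<^sub>2 = {}"
    "H\<^sub>1 = induced_subgraph G U\<^sub>1" "H\<^sub>2 = induced_subgraph G U\<^sub>2"
    "\<forall>e\<in>edges G. e \<subseteq> U\<^sub>1 \<or> e \<subseteq> U\<^sub>2"
proof -
  \<comment> \<open>Reachability is symmetric and transitive, so two classes \<open>R a\<close> and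
    \<open>R b\<close> are equal or disjoint; distinct components come from disjoint
    classes.\<close>
  define R where "R a = {w \<in> verts G. (a, w) \<in> (adj_rel G)\<^sup>*}" for a
  have "sym (adj_rel G)" by (auto simp: sym_def adj_rel_def insert_commute)
  then have sym: "sym ((adj_rel G)\<^sup>*)" by (rule sym_rtrancl)
  have comp: "component_of G a = induced_subgraph G (R a)" for a
    by (simp add: component_of_def R_def)
  have R_eq: "R a = R b" if "(a, b) \<in> (adj_rel G)\<^sup>*" for a b
    using that symD[OF sym that] by (auto simp: R_def)
  obtain a b where ab: "H\<^sub>1 = induced_subgraph G (R a)" "H\<^sub>2 = induced_subgraph G (R b)"
    using comps comp unfolding components_def by (metis imageE insertI1 insertI2)
  have disj: "R a \<inter> R b = {}"
  proof (rule ccontr)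
    assume "R a \<inter> R b \<noteq> {}"
    then obtain w where "(a, w) \<in> (adj_rel G)\<^sup>*" "(b, w) \<in> (adj_rel G)\<^sup>*" by (auto simp: R_def)
    then have "R a = R b" using R_eq by metis
    then show False using ne ab by simp
  qed
  have in_R: "R w = R a \<or> R w = R b" if "w \<in> verts G" for w
  proof -
    have "component_of G w \<in> {H\<^sub>1, H\<^sub>2}" using that comps by (auto simp: components_def)
    then show ?thesis unfolding ab comp by (auto simp: induced_subgraph_def)
  qed
  moreover have "w \<in> R w" if "w \<in> verts G" for w using that by (simp add: R_def)
  moreover have "R a \<union> R b \<subseteq> verts G" by (auto simp: R_def)
  ultimately have "verts G = R a \<union> R b" by auto
  moreover have "e \<subseteq> R a \<or> e \<subseteq> R b" if e: "e \<in> edges G" for e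
  proof -
    have "card e = 2" using G e by (simp add: simple_graph_def)
    then obtain x where "x \<in> e" by fastforce
    then obtain y where xy: "e = {x, y}" "x \<in> verts G" "y \<in> verts G"
      by (rule simple_graph_edgeE[OF G e])
    then have "(x, y) \<in> (adj_rel G)\<^sup>*" using e by (auto simp: adj_rel_def)
    then have "e \<subseteq> R x" using xy by (auto simp: R_def)
    then show ?thesis using in_R xy(2) by metis
  qed
  ultimately show ?thesis using disj ab by (intro that[of "R a" "R b"]) auto
qed

text \<open>Deleting the edge \<open>{a, b}\<close> subtracts the rank-one matrix \<open>w w\<^sup>T\<close> with
  \<open>w\<close> the difference of the indicators of \<open>a\<close> and \<open>b\<close>.\<close>

lemma laplacian_kernel_delete_edge:
  assumes G: "simple_graph G" and e: "{a, b} \<in> edges G"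
  defines "w \<equiv> \<lambda>v. (if v = a then 1 else if v = b then -1 else 0 :: real)"
  shows "laplacian_kernel G u v = laplacian_kernel (delete_edge G {a, b}) u v + w u * w v"
proof -
  have ab: "a \<noteq> b" using G e by (auto simp: simple_graph_def)
  let ?H = "delete_edge G {a, b}"
  have deg: "vdegree G u = vdegree ?H u + (if u \<in> {a, b} then 1 else 0)"
  proof (cases "u \<in> {a, b}")
    case True
    then have "{f \<in> edges G. u \<in> f} = insert {a, b} {f \<in> edges ?H. u \<in> f}"
      using e by (auto simp: delete_edge_def)
    moreover have "finite {f \<in> edges ?H. u \<in> f}" "{a, b} \<notin> {f \<in> edges ?H. u \<in> f}"
      using simple_graph_finite(2)[OF G] by (auto simp: delete_edge_def)
    ultimately show ?thesis using True by (simp only: vdegree_def card_insert_disjoint if_True Suc_eq_plus1 not_False_eq_True)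
  next
    case False
    then have "{f \<in> edges G. u \<in> f} = {f \<in> edges ?H. u \<in> f}"
      by (auto simp: delete_edge_def)
    then show ?thesis using False by (simp only: vdegree_def if_False)
  qed
  have edge: "{u, v} \<in> edges G \<longleftrightarrow> {u, v} \<in> edges ?H \<or> {u, v} = {a, b}" "{a, b} \<notin> edges ?H"
    using e by (auto simp: delete_edge_def)
  \<comment> \<open>In the last case \<open>w u = 0\<close>, and neither the degree of
    \<open>u\<close> nor its adjacencies change.\<close>
  consider "u = a" "v = a" | "u = a" "v = b" | "u = a" "v \<notin> {a, b}" | "u = b" "v = a" | "u = b" "v = b"
    | "u = b" "v \<notin> {a, b}" | "u \<notin> {a, b}" by blast
  then show ?thesis
    using ab edge(2) unfolding laplacian_kernel_def w_def deg edge(1)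
    by cases (auto simp: doubleton_eq_iff insert_commute)
qed

text \<open>The Laplacian form of \<open>G\<close> exceeds that of the smaller graph by a square, so
  the eigenvalue comparison applies. \<open>P\<close> and \<open>d\<close> are independent:
  eigenvalues may be selected by one threshold and measured against another.\<close>

lemma sum_laplacian_excess_delete_edge_le:
  assumes G: "simple_graph G" and e: "e \<in> edges G"
  shows "(\<Sum>\<mu>\<in>#filter_mset P (laplacian_spectrum (delete_edge G e)). \<mu> - d)
    \<le> (\<Sum>\<mu>\<in>#laplacian_spectrum G. max 0 (\<mu> - d))"
proof -
  define H where "H = delete_edge G e"
  define n where "n = card (verts G)"
  have verts_H: "verts H = verts G" by (simp add: H_def delete_edge_def)
  note finG = simple_graph_finite(1)[OF G]
  then have finH: "finite (verts H)" by (simp add: verts_H)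
  obtain a b where ab: "e = {a, b}" using G e by (auto simp: simple_graph_def card_2_iff)
  define w where "w v = (if v = a then 1 else if v = b then -1 else 0 :: real)" for v
  define xs where "xs = vertex_list G"
  have len: "length xs = n" using vertex_list(3)[OF finG] by (simp add: xs_def n_def)
  have LG: "laplacian_matrix G = kernel_mat (laplacian_kernel G) xs"
    using laplacian_matrix_eq_kernel_mat[OF finG] by (simp add: xs_def)
  \<comment> \<open>\<open>vertex_list\<close> depends only on the vertex set, so both Laplacians
    use the same enumeration.\<close>
  have LH: "laplacian_matrix H = kernel_mat (laplacian_kernel H) xs"
    using laplacian_matrix_eq_kernel_mat[OF finH] by (simp add: xs_def vertex_list_def verts_H)
  have kernel: "laplacian_kernel G u v = laplacian_kernel H u v + w u * w v" for u v
    using laplacian_kernel_delete_edge[OF G e[unfolded ab]] by (simp add: H_def ab w_def)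
  have le: "x \<bullet> (laplacian_matrix H *\<^sub>v x) \<le> x \<bullet> (laplacian_matrix G *\<^sub>v x)"
    if x: "x \<in> carrier_vec n" for x
  proof -
    \<comment> \<open>The rank-one term contributes the square of the inner product of
      \<open>w\<close> and \<open>x\<close>.\<close>
    have "x \<bullet> (laplacian_matrix G *\<^sub>v x) - x \<bullet> (laplacian_matrix H *\<^sub>v x) =
      (\<Sum>i<n. \<Sum>j<n. (w (xs ! i) * x $ i) * (w (xs ! j) * x $ j))"
      unfolding LG LH using x len
      by (simp add: quadratic_form_kernel_mat kernel sum_subtractf[symmetric] algebra_simps)
    also have "\<dots> = (\<Sum>i<n. w (xs ! i) * x $ i)\<^sup>2"
      by (simp add: power2_eq_square sum_product)
    finally show ?thesis by (metis diff_ge_0_iff_ge zero_le_power2)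
  qed
  obtain as where as: "char_poly (laplacian_matrix H) = (\<Prod>e\<leftarrow>as. [:- e, 1:])"
    "laplacian_spectrum H = mset as" "length as = n"
    using laplacian_spectrum_list[OF finH] unfolding verts_H n_def .
  obtain bs where bs: "char_poly (laplacian_matrix G) = (\<Prod>e\<leftarrow>bs. [:- e, 1:])"
    "laplacian_spectrum G = mset bs" "length bs = n"
    using laplacian_spectrum_list[OF finG] unfolding n_def .
  have "(\<Sum>i\<in>{i. i < n \<and> P (as ! i)}. as ! i - d) \<le> (\<Sum>j<n. max 0 (bs ! j - d))"
    by (rule sum_eigenvalue_excess_le[OF _ _ _ _ le as(1) bs(1)])
      (use laplacian_matrix_symmetric[OF finH] laplacian_matrix_symmetric[OF finG]
        in \<open>auto simp: verts_H n_def\<close>)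
  moreover have "(\<Sum>\<mu>\<in>#laplacian_spectrum G. max 0 (\<mu> - d)) = (\<Sum>j<n. max 0 (bs ! j - d))"
    using sum_mset_filter_mset_nth[of "\<lambda>\<mu>. max 0 (\<mu> - d)" "\<lambda>_. True" bs]
    by (simp add: bs lessThan_def)
  ultimately show ?thesis
    using sum_mset_filter_mset_nth[of "\<lambda>\<mu>. \<mu> - d" P as] by (simp add: as H_def[symmetric])
qed

section \<open>The energy bound for a tree\<close>

theorem theorem3p2:
  fixes T T\<^sub>1 T\<^sub>2 :: "'a ugraph" and e :: "'a set" and n \<sigma> k\<^sub>1 k\<^sub>2 :: nat
  assumes "tree T" and "card (verts T) = n" and "n \<ge> 8"
    and "non_pendent_edge T e"
    and "components (delete_edge T e) = {T\<^sub>1, T\<^sub>2}" and "T\<^sub>1 \<noteq> T\<^sub>2"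
    and "\<sigma> = count_eigenvalues_ge (avg_degree (delete_edge T e)) (delete_edge T e)"
    and "k\<^sub>1 = count_eigenvalues_ge (avg_degree (delete_edge T e)) T\<^sub>1"
    and "k\<^sub>2 = count_eigenvalues_ge (avg_degree (delete_edge T e)) T\<^sub>2"
  shows "avg_degree (delete_edge T e) = 2 - 4 / real n \<and>
    k\<^sub>1 + k\<^sub>2 = \<sigma> \<and>
    laplacian_energy T \<ge> 2 * sum_largest k\<^sub>1 T\<^sub>1 + 2 * sum_largest k\<^sub>2 T\<^sub>2
      - 4 * real \<sigma> + 4 * real \<sigma> / real n"
proof -
  define F where "F = delete_edge T e"
  define c where "c = avg_degree F"
  define d where "d = avg_degree T"
  have T: "simple_graph T" using assms(1) by (simp add: tree_def)
  have e: "e \<in> edges T" using assms(4) by (simp add: non_pendent_edge_def)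
  have F: "simple_graph F" using T by (auto simp: F_def simple_graph_def delete_edge_def)
  have card_T: "card (edges T) + 1 = n" using tree_card_edges[OF assms(1)] assms(2) by simp
  then have card_T': "real (card (edges T)) = real n - 1" by linarith
  have card_F: "real (card (edges F)) = real n - 2"
    using card_T assms(3) e by (simp add: F_def delete_edge_def card_Diff_singleton of_nat_diff)
  have verts_F: "card (verts F) = n" using assms(2) by (simp add: F_def delete_edge_def)
  have c: "c = 2 - 4 / real n"
    using assms(3) by (simp add: c_def avg_degree_def card_F verts_F field_simps)
  have d: "d = 2 - 2 / real n"
    using assms(3) by (simp add: d_def avg_degree_def card_T' assms(2) field_simps)
  obtain U\<^sub>1 U\<^sub>2 where U: "verts F = U\<^sub>1 \<union> U\<^sub>2" "U\<^sub>1 \<inter> U\<^sub>2 = {}"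
    "T\<^sub>1 = induced_subgraph F U\<^sub>1" "T\<^sub>2 = induced_subgraph F U\<^sub>2"
    "\<forall>e\<in>edges F. e \<subseteq> U\<^sub>1 \<or> e \<subseteq> U\<^sub>2"
    using two_components[OF F assms(5)[folded F_def] assms(6)] .
  have spec: "laplacian_spectrum F = laplacian_spectrum T\<^sub>1 + laplacian_spectrum T\<^sub>2"
    using laplacian_spectrum_disjoint_union[OF F U(1,2)] U(5) by (simp add: U(3,4))
  let ?M = "{#\<mu> \<in># laplacian_spectrum F. \<mu> \<ge> c#}"
  have \<sigma>: "\<sigma> = size ?M"
    using assms(7) by (simp add: count_eigenvalues_ge_def F_def[symmetric] c_def)
  have k: "k\<^sub>1 = count_eigenvalues_ge c T\<^sub>1" "k\<^sub>2 = count_eigenvalues_ge c T\<^sub>2"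
    using assms(8,9) by (simp_all add: F_def[symmetric] c_def)
  have "k\<^sub>1 + k\<^sub>2 = \<sigma>" by (simp add: \<sigma> k spec count_eigenvalues_ge_def)
  have S: "sum_largest k\<^sub>1 T\<^sub>1 + sum_largest k\<^sub>2 T\<^sub>2 = \<Sum>\<^sub># ?M"
    by (simp add: k sum_largest_count_eigenvalues_ge spec)
  have "(\<Sum>\<mu>\<in>#M. \<mu> - d) = \<Sum>\<^sub># M - real (size M) * d" for M
    by (induction M) (simp_all add: algebra_simps)
  note this[of ?M]
  \<comment> \<open>Eigenvalues are selected by \<open>c\<close> but measured against the larger
    \<open>d\<close>. Those between \<open>c\<close> and \<open>d\<close> contribute negative terms,
    which the inequality permits.\<close>
  moreover have "2 * (\<Sum>\<mu>\<in>#?M. \<mu> - d) \<le> laplacian_energy T"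
    using sum_laplacian_excess_delete_edge_le[OF T e, where P = "\<lambda>\<mu>. \<mu> \<ge> c" and d = d]
    unfolding laplacian_energy_eq[OF T] F_def d_def by linarith
  ultimately have "2 * \<Sum>\<^sub># ?M - 2 * (real \<sigma> * d) \<le> laplacian_energy T"
    unfolding \<sigma> by simp
  \<comment> \<open>Here \<open>d = 2 - 2 / real n\<close> produces both correction terms of the
    bound.\<close>
  moreover have "2 * (real \<sigma> * d) = 4 * real \<sigma> - 4 * real \<sigma> / real n"
    by (simp add: d algebra_simps)
  ultimately have "laplacian_energy T \<ge> 2 * sum_largest k\<^sub>1 T\<^sub>1 + 2 * sum_largest k\<^sub>2 T\<^sub>2
      - 4 * real \<sigma> + 4 * real \<sigma> / real n"
    using S by linarith
  with \<open>k\<^sub>1 + k\<^sub>2 = \<sigma>\<close> c show ?thesis by (simp add: c_def F_def)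
qed

end
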